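(* Let $\{f_n\}_{n\ge1}$ and $f$ be probability density functions on $\mathbb{R}^d$ with $H(f)$ finite. If there are constants $m,v,\alpha>0$ such that, for all $n$, $f_n(x)\le m$ and $\int_{\mathbb{R}^d}\lvert x\rvert^\alpha f_n(x)\,dx\le v$, and if $\lVert f_n-f\rVert_1\to0$, then $H(f_n)\to H(f)$.
   Context: A probability density function (pdf) on $\mathbb{R}^d$ is a measurable $f:\mathbb{R}^d\to[0,\infty)$ with $\int f\,dx=1$. The differential entropy is $H(f)=-\int_{\mathbb{R}^d} f\log f\,dx$, with natural logarithm and the convention $0\log0=0$. "$H(f)$ finite" means $f\log f\in L^1(\mathbb{R}^d)$. $\lvert x\rvert$ is the Euclidean norm and $\lVert\cdot\rVert_1$ is the $L^1(\mathbb{R}^d)$ norm with respect to Lebesgue measure. *)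

theory Defs
  imports "HOL-Analysis.Analysis"
begin

text \<open>Densities are Lebesgue measurable (this includes Borel measurable ones), and all
  integrals are taken over \<^const>\<open>lebesgue\<close>.\<close>

definition pdf :: "('a::euclidean_space \<Rightarrow> real) \<Rightarrow> bool" where
  "pdf f \<longleftrightarrow> f \<in> borel_measurable lebesgue \<and> (\<forall>x. 0 \<le> f x)
     \<and> (\<integral>\<^sup>+ x. ennreal (f x) \<partial>lebesgue) = 1"

text \<open>Where \<open>f x = 0\<close>, the product \<open>f x * ln (f x)\<close> is \<open>0\<close>, which is the convention
  \<open>0 log 0 = 0\<close>. The Bochner integral defaults to \<open>0\<close> for a non-integrable integrand,
  so \<open>diff_entropy f\<close> is meaningful only together with \<open>finite_entropy f\<close>.\<close>

definition finite_entropy :: "('a::euclidean_space \<Rightarrow> real) \<Rightarrow> bool" where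
  "finite_entropy f \<longleftrightarrow> integrable lebesgue (\<lambda>x. f x * ln (f x))"

definition diff_entropy :: "('a::euclidean_space \<Rightarrow> real) \<Rightarrow> real" where
  "diff_entropy f = - (\<integral>x. f x * ln (f x) \<partial>lebesgue)"

end

theory Submission
  imports Defs "HOL-Real_Asymp.Real_Asymp"
begin

text \<open>
  Both semicontinuity estimates come from Fatou's lemma along almost everywhere convergent
  subsequences, applied to nonnegative functions that differ from $\pm t \log t$ by terms whose
  integrals are under control. From above, $t \log m - t \log t \ge 0$ on $[0, m]$. From below,
  $t \log t + \varepsilon |x|^\alpha t + e^{-1 - \varepsilon |x|^\alpha} \ge 0$, where the moment
  term has integral at most $\varepsilon v$ and the last term is integrable and independent of $t$.
\<close>

text \<open>The endpoint 0 is included so that limits of densities can be taken also at points where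
  the limit density vanishes.\<close>

lemma continuous_on_mult_ln: "continuous_on {0..} (\<lambda>t::real. t * ln t)"
proof -
  have "((\<lambda>t::real. t * ln t) \<longlongrightarrow> 0 * ln 0) (at 0 within {0..})"
  proof -
    have "((\<lambda>t::real. t * ln t) \<longlongrightarrow> 0) (at_right 0)"
      by real_asymp
    then show ?thesis by (simp add: at_within_Ici_at_right)
  qed
  moreover have "((\<lambda>t::real. t * ln t) \<longlongrightarrow> x * ln x) (at x within {0..})" if "x > 0" for x
    using that by (intro tendsto_intros) auto
  ultimately show ?thesis
    unfolding continuous_on_def by (metis atLeast_iff less_eq_real_def)
qed

text \<open>For fixed \<open>w\<close>, the convex function \<open>t * ln t + w * t\<close> attains
  its minimum \<open>- exp (- 1 - w)\<close> at \<open>t = exp (- 1 - w)\<close>. The proof applies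
  \<open>ln s \<le> s - 1\<close> to the ratio \<open>s\<close> of this minimizer to
  \<open>t\<close>.\<close>

lemma mult_ln_lower_bound:
  fixes t w :: real
  assumes "t \<ge> 0"
  shows "0 \<le> t * ln t + w * t + exp (- 1 - w)"
proof (cases "t = 0")
  case False
  with assms have t: "t > 0" by simp
  let ?s = "exp (- 1 - w) / t"
  have "ln ?s \<le> ?s - 1"
    using t by (intro ln_le_minus_one) simp
  then have "- w - ln t \<le> ?s"
    using t by (simp add: ln_div)
  then have "t * (- w - ln t) \<le> t * ?s"
    using t by (intro mult_left_mono) auto
  then show ?thesis
    using t by (simp add: algebra_simps)
qed simp

lemma borel_measurable_lebesgue_if_borel:
  fixes g :: "'a::euclidean_space \<Rightarrow> real"
  assumes "g \<in> borel_measurable borel"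
  shows "g \<in> borel_measurable lebesgue"
  using assms by (simp add: measurable_completion)

text \<open>Where \<open>k \<le> norm x < k + 1\<close>, the integrand is at most its value at
  radius \<open>k\<close>, and this shell lies in the ball of radius \<open>k + 1\<close>, whose
  volume grows only polynomially in \<open>k\<close>. The integral is thus dominated by a convergent
  series.\<close>

lemma integrable_exp_minus_norm_powr:
  fixes a c :: real
  assumes a: "a > 0" and c: "c > 0"
  shows "integrable lebesgue (\<lambda>x::'a::euclidean_space. exp (- (c * norm x powr a)))"
proof (rule integrableI_nonneg)
  let ?g = "\<lambda>x::'a. exp (- (c * norm x powr a))"
  let ?d = "DIM('a)"
  let ?V = "unit_ball_vol (real ?d)"
  let ?b = "\<lambda>k::nat. exp (- (c * real k powr a)) * real (Suc k) ^ ?d"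
  show "?g \<in> borel_measurable lebesgue"
    by (rule borel_measurable_lebesgue_if_borel) measurable
  show "AE x in lebesgue. 0 \<le> ?g x" by simp
  have le_suminf: "g k \<le> suminf g" for g :: "nat \<Rightarrow> ennreal" and k
    using sum_le_suminf [of g "{k}"] by simp
  have shell: "ennreal (?g x) \<le> (\<Sum>k. ennreal (exp (- (c * real k powr a))) *
                 indicator (ball 0 (real (Suc k))) x)" (is "_ \<le> (\<Sum>k. ?h k x)") for x :: 'a
  proof -
    define k where "k = nat \<lfloor>norm x\<rfloor>"
    have k: "real k \<le> norm x" "norm x < real (Suc k)"
      unfolding k_def by (simp_all add: of_nat_floor) linarith
    have "real k powr a \<le> norm x powr a"
      using k a by (intro powr_mono2) auto
    then have "?g x \<le> exp (- (c * real k powr a))"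
      using c by simp
    then have "ennreal (?g x) \<le> ?h k x"
      using k by (simp add: ennreal_leI)
    also have "\<dots> \<le> (\<Sum>k. ?h k x)"
      by (rule le_suminf)
    finally show ?thesis .
  qed
  \<comment> \<open>The stretched exponential beats every power of \<open>k\<close>, so comparison
    with inverse squares suffices.\<close>
  have "?b \<in> O(\<lambda>k. 1 / real k ^ 2)"
    using a c by real_asymp
  then have summable: "summable ?b"
    by (rule summable_comparison_test_bigo [rotated])
       (use inverse_power_summable [of 2, where 'a = real] in \<open>simp add: inverse_eq_divide\<close>)
  have [measurable]: "ball (0::'a) r \<in> sets lebesgue" for r
    by simp
  have "(\<integral>\<^sup>+x. ennreal (?g x) \<partial>lebesgue) \<le> (\<integral>\<^sup>+x. (\<Sum>k. ?h k x) \<partial>lebesgue)"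
    by (intro nn_integral_mono shell)
  also have "\<dots> = (\<Sum>k. \<integral>\<^sup>+x. ?h k x \<partial>lebesgue)"
    by (rule nn_integral_suminf) measurable
  also have "\<dots> = (\<Sum>k. ennreal (?V * ?b k))"
    by (intro suminf_cong)
       (simp add: nn_integral_cmult_indicator emeasure_ball ennreal_mult [symmetric]
          del: of_nat_Suc)
  also have "\<dots> = ennreal (\<Sum>k. ?V * ?b k)"
    using summable by (intro suminf_ennreal2 summable_mult) auto
  also have "\<dots> < \<infinity>" by simp
  finally show "(\<integral>\<^sup>+x. ennreal (?g x) \<partial>lebesgue) < \<infinity>" .
qed

text \<open>Lower semicontinuity under convergence in L1. The bound \<open>B\<close> is asked for
  only infinitely many \<open>n\<close>, which is what the negation of an eventual strict inequality
  provides. Integrability is part of the conclusion because the Bochner integral of a non-integrable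
  function is 0, and the bound alone would then say nothing.\<close>

lemma Fatou_L1_convergent:
  fixes u :: "nat \<Rightarrow> 'a \<Rightarrow> real" and f :: "'a \<Rightarrow> real" and F :: "'a \<Rightarrow> real \<Rightarrow> real"
  assumes u: "\<And>n. integrable M (u n)" "\<And>n x. u n x \<ge> 0"
    and f: "integrable M f" "\<And>x. f x \<ge> 0"
    and L1: "(\<lambda>n. \<integral>x. \<bar>u n x - f x\<bar> \<partial>M) \<longlonglongrightarrow> 0"
    and cont: "\<And>x. continuous_on {0..} (F x)"
    and nonneg: "\<And>n x. F x (u n x) \<ge> 0"
    and int: "\<And>n. integrable M (\<lambda>x. F x (u n x))"
    and meas: "(\<lambda>x. F x (f x)) \<in> borel_measurable M"
    and freq: "\<exists>\<^sub>F n in sequentially. (\<integral>x. F x (u n x) \<partial>M) \<le> B"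
  shows "integrable M (\<lambda>x. F x (f x))" and "(\<integral>x. F x (f x) \<partial>M) \<le> B"
proof -
  \<comment> \<open>Two successive extractions: \<open>r\<close> selects indices at which the bound
    holds, and \<open>s\<close> refines it to get convergence almost everywhere.\<close>
  obtain r where r: "strict_mono (r :: nat \<Rightarrow> nat)" "\<And>n. (\<integral>x. F x (u (r n) x) \<partial>M) \<le> B"
    using not_eventually_sequentiallyD [OF freq [unfolded frequently_def]] by auto
  have "(\<lambda>n. \<integral>x. norm (u (r n) x - f x) \<partial>M) \<longlonglongrightarrow> 0"
    using LIMSEQ_subseq_LIMSEQ [OF L1 r(1)] by (simp add: o_def)
  then obtain s where s: "strict_mono (s :: nat \<Rightarrow> nat)"
      "AE x in M. (\<lambda>n. u (r (s n)) x - f x) \<longlonglongrightarrow> 0"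
    using tendsto_L1_AE_subseq [of M "\<lambda>n x. u (r n) x - f x"] u f by auto
  define p where "p = r \<circ> s"
  have le: "(\<integral>x. F x (u (p n) x) \<partial>M) \<le> B" for n
    using r(2) by (simp add: p_def)
  \<comment> \<open>\<open>ennreal\<close> sends negative reals to 0, so the sign of
    \<open>B\<close> is needed to bring the final estimate back to the reals.\<close>
  have B: "0 \<le> B"
    by (rule order_trans [OF integral_nonneg_AE le [of 0]]) (simp add: nonneg)
  have AE_lim: "AE x in M. (\<lambda>n. F x (u (p n) x)) \<longlonglongrightarrow> F x (f x)"
    using s(2)
  proof eventually_elim
    case (elim x)
    then have "(\<lambda>n. u (p n) x) \<longlonglongrightarrow> f x"
      by (simp add: p_def LIM_zero_iff)
    then show ?case
      using u f by (intro continuous_on_tendsto_compose [OF cont]) auto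
  qed
  \<comment> \<open>Nonnegativity is assumed only at the values \<open>u n x\<close>; at
    \<open>f x\<close> it is inherited from the limit, hence only almost everywhere.\<close>
  then have AE_nonneg: "AE x in M. 0 \<le> F x (f x)"
    by eventually_elim (rule LIMSEQ_le_const, use nonneg in auto)
  have [measurable]: "(\<lambda>x. F x (u n x)) \<in> borel_measurable M" for n
    using int by blast
  have "(\<integral>\<^sup>+x. ennreal (F x (f x)) \<partial>M) =
      (\<integral>\<^sup>+x. liminf (\<lambda>n. ennreal (F x (u (p n) x))) \<partial>M)"
    using AE_lim
    by (intro nn_integral_cong_AE, eventually_elim)
       (auto intro!: lim_imp_Liminf [symmetric] tendsto_ennrealI)
  also have "\<dots> \<le> liminf (\<lambda>n. \<integral>\<^sup>+x. ennreal (F x (u (p n) x)) \<partial>M)"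
    by (intro nn_integral_liminf) simp
  also have "\<dots> = liminf (\<lambda>n. ennreal (\<integral>x. F x (u (p n) x) \<partial>M))"
    using int nonneg by (simp add: nn_integral_eq_integral)
  also have "\<dots> \<le> liminf (\<lambda>n::nat. ennreal B)"
    by (intro Liminf_mono always_eventually allI ennreal_leI le)
  also have "\<dots> = ennreal B" 
    by (simp add: Liminf_const)
  finally have *: "(\<integral>\<^sup>+x. ennreal (F x (f x)) \<partial>M) \<le> ennreal B" .
  show int_lim: "integrable M (\<lambda>x. F x (f x))"
    using meas AE_nonneg * by (intro integrableI_nonneg) (auto simp: le_less_trans)
  show "(\<integral>x. F x (f x) \<partial>M) \<le> B"
    using * B by (simp add: nn_integral_eq_integral [OF int_lim AE_nonneg])
qed

lemma pdf_integrable: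
  assumes "pdf f"
  shows "integrable lebesgue f" and "(\<integral>x. f x \<partial>lebesgue) = 1"
proof -
  show "integrable lebesgue f"
    using assms by (intro integrableI_nonneg) (auto simp: pdf_def)
  then show "(\<integral>x. f x \<partial>lebesgue) = 1"
    using assms by (simp add: pdf_def integral_eq_nn_integral)
qed

theorem corollary13:
  fixes fn :: "nat \<Rightarrow> 'a::euclidean_space \<Rightarrow> real" and f :: "'a \<Rightarrow> real"
    and m v \<alpha> :: real
  assumes "\<And>n. pdf (fn n)" and "pdf f"
    and "finite_entropy f"
    and "m > 0" and "v > 0" and "\<alpha> > 0"
    and "\<And>n x. fn n x \<le> m"
    and "\<And>n. (\<integral>\<^sup>+ x. ennreal (norm x powr \<alpha> * fn n x) \<partial>lebesgue) \<le> ennreal v"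
    and "(\<lambda>n. \<integral>x. \<bar>fn n x - f x\<bar> \<partial>lebesgue) \<longlonglongrightarrow> 0"
  shows "(\<forall>n. finite_entropy (fn n)) \<and> (\<lambda>n. diff_entropy (fn n)) \<longlonglongrightarrow> diff_entropy f"
proof -
  note pdf_fn = assms(1) and pdf_f = assms(2) and L1 = assms(9)
  have nonneg [simp]: "0 \<le> fn n x" "0 \<le> f x" for n x
    using pdf_fn pdf_f by (auto simp: pdf_def)
  have int_fn [simp]: "integrable lebesgue (fn n)" "(\<integral>x. fn n x \<partial>lebesgue) = 1" for n
    using pdf_integrable [OF pdf_fn] by auto
  have int_f [simp]: "integrable lebesgue f" "(\<integral>x. f x \<partial>lebesgue) = 1"
    using pdf_integrable [OF pdf_f] by auto
  have [measurable]: "fn n \<in> borel_measurable lebesgue" "f \<in> borel_measurable lebesgue" for n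
    using pdf_fn pdf_f by (auto simp: pdf_def)
  have [measurable]: "(\<lambda>x::'a. norm x powr \<alpha>) \<in> borel_measurable lebesgue"
    by (rule borel_measurable_lebesgue_if_borel) measurable
  let ?\<phi> = "\<lambda>t::real. t * ln t"
  let ?m = "\<lambda>n x. norm x powr \<alpha> * fn n x"
  let ?e = "\<lambda>\<epsilon> (x::'a). exp (- 1 - \<epsilon> * norm x powr \<alpha>)"
  have int_m [simp]: "integrable lebesgue (?m n)" for n
    using le_less_trans [OF assms(8)] by (intro integrableI_nonneg) auto
  have m_le: "(\<integral>x. ?m n x \<partial>lebesgue) \<le> v" for n
    using assms(8) [of n] \<open>v > 0\<close> by (simp add: nn_integral_eq_integral)
  have int_e [simp]: "integrable lebesgue (?e \<epsilon>)" if "\<epsilon> > 0" for \<epsilon>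
    using integrable_mult_right [OF integrable_exp_minus_norm_powr [OF \<open>\<alpha> > 0\<close> that],
        where c = "exp (-1)"]
    by (simp add: exp_add [symmetric])
  have upper: "?\<phi> (fn n x) \<le> ln m * fn n x" for n x
  proof (cases "fn n x = 0")
    case False
    then have "fn n x > 0"
      using nonneg(1) [of n x] by linarith
    then show ?thesis
      using assms(4,7) by (simp add: mult.commute)
  qed simp
  have lower: "0 \<le> ?\<phi> (fn n x) + \<epsilon> * norm x powr \<alpha> * fn n x + ?e \<epsilon> x" for n x \<epsilon>
    by (rule mult_ln_lower_bound) simp
  \<comment> \<open>Each \<open>fn n\<close> has finite entropy: \<open>upper\<close> together with
    \<open>lower\<close> at \<epsilon> = 1 bounds \<open>?\<phi> (fn n x)\<close> on both sides by
    an integrable function. The absolute value of \<open>ln m\<close> covers the case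
    \<open>m < 1\<close>.\<close>
  have int_\<phi> [simp]: "integrable lebesgue (\<lambda>x. ?\<phi> (fn n x))" for n
  proof (rule Bochner_Integration.integrable_bound)
    let ?G = "\<lambda>x. \<bar>ln m\<bar> * fn n x + ?m n x + ?e 1 x"
    show "integrable lebesgue ?G"
      by (intro Bochner_Integration.integrable_add integrable_mult_right int_fn int_m int_e) simp
    show "AE x in lebesgue. norm (?\<phi> (fn n x)) \<le> norm (?G x)"
    proof (rule AE_I2)
      fix x
      have "ln m * fn n x \<le> \<bar>ln m\<bar> * fn n x"
        by (intro mult_right_mono) auto
      moreover have "0 \<le> \<bar>ln m\<bar> * fn n x" "0 \<le> ?m n x" "0 \<le> ?e 1 x"
        by simp_all
      ultimately show "norm (?\<phi> (fn n x)) \<le> norm (?G x)"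
        using upper [of n x] lower [of n x 1] unfolding real_norm_def by linarith
    qed
  qed measurable
  have int_\<phi>f [simp]: "integrable lebesgue (\<lambda>x. ?\<phi> (f x))"
    using assms(3) by (simp add: finite_entropy_def)
  let ?I = "\<lambda>n. \<integral>x. ?\<phi> (fn n x) \<partial>lebesgue"
  let ?J = "\<integral>x. ?\<phi> (f x) \<partial>lebesgue"
  have "?I \<longlonglongrightarrow> ?J"
  proof (rule order_tendstoI)
    fix a assume a: "a > ?J"
    show "\<forall>\<^sub>F n in sequentially. ?I n < a"
    proof (rule ccontr)
      assume "\<not> ?thesis"
      then have ev: "\<exists>\<^sub>F n in sequentially. a \<le> ?I n"
        by (simp add: frequently_def not_le)
      \<comment> \<open>Since \<open>f\<close> has integral 1 and finite entropy, the left side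
        equals \<open>ln m - ?J\<close>, so this bound gives \<open>a \<le> ?J\<close>.\<close>
      have "(\<integral>x. ln m * f x - ?\<phi> (f x) \<partial>lebesgue) \<le> ln m - a"
      proof (rule Fatou_L1_convergent(2) [where u = fn and f = f and F = "\<lambda>x t. ln m * t - ?\<phi> t"])
        show "\<exists>\<^sub>F n in sequentially. (\<integral>x. ln m * fn n x - ?\<phi> (fn n x) \<partial>lebesgue) \<le> ln m - a"
          using ev by simp
        show "continuous_on {0..} (\<lambda>t. ln m * t - ?\<phi> t)"
          by (intro continuous_on_diff continuous_on_mult_ln continuous_on_mult_left continuous_on_id)
        show "integrable lebesgue (\<lambda>x. ln m * fn n x - ?\<phi> (fn n x))" for n
          by (intro Bochner_Integration.integrable_diff integrable_mult_right int_fn int_\<phi>)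
        show "(\<lambda>x. ln m * f x - ?\<phi> (f x)) \<in> borel_measurable lebesgue"
          by measurable
      qed (use L1 upper in simp_all)
      then show False
        using a by simp
    qed
  next
    fix a assume a: "a < ?J"
    \<comment> \<open>With this choice the moment term costs at most half of the gap between
      \<open>a\<close> and \<open>?J\<close>.\<close>
    define \<epsilon> where "\<epsilon> = (?J - a) / (2 * v)"
    have \<epsilon>: "\<epsilon> > 0" "\<epsilon> * v < ?J - a"
      using a \<open>v > 0\<close> by (simp_all add: \<epsilon>_def)
    let ?F = "\<lambda>x t. ?\<phi> t + \<epsilon> * norm x powr \<alpha> * t + ?e \<epsilon> x"
    let ?B = "a + \<epsilon> * v + (\<integral>x. ?e \<epsilon> x \<partial>lebesgue)"
    have int_em: "integrable lebesgue (\<lambda>x. \<epsilon> * norm x powr \<alpha> * fn n x)"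
      and em: "(\<integral>x. \<epsilon> * norm x powr \<alpha> * fn n x \<partial>lebesgue) \<le> \<epsilon> * v" for n
      using m_le [of n] \<epsilon> int_m by (simp_all add: mult.assoc)
    show "\<forall>\<^sub>F n in sequentially. a < ?I n"
    proof (rule ccontr)
      assume "\<not> ?thesis"
      then have ev: "\<exists>\<^sub>F n in sequentially. ?I n \<le> a"
        by (simp add: frequently_def not_le)
      have freq: "\<exists>\<^sub>F n in sequentially. (\<integral>x. ?F x (fn n x) \<partial>lebesgue) \<le> ?B"
        using ev
      proof (rule frequently_elim1)
        fix n assume "?I n \<le> a"
        then show "(\<integral>x. ?F x (fn n x) \<partial>lebesgue) \<le> ?B"
          using em [of n] int_em \<epsilon> by simp
      qed
      have cont: "continuous_on {0..} (?F x)" for x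
        by (intro continuous_on_add continuous_on_mult_ln continuous_on_mult_left
            continuous_on_id continuous_on_const)
      have int_F: "integrable lebesgue (\<lambda>x. ?F x (fn n x))" for n
        by (intro Bochner_Integration.integrable_add int_\<phi> int_em int_e \<epsilon>)
      have meas_F: "(\<lambda>x. ?F x (f x)) \<in> borel_measurable lebesgue"
        by measurable
      note F = Fatou_L1_convergent [where F = ?F, OF int_fn(1) nonneg(1) int_f(1) nonneg(2)
          L1 cont lower int_F meas_F freq]
      \<comment> \<open>The nonnegative moment term of \<open>f\<close> is dropped; the first
        conclusion in \<open>F\<close> supplies the integrability that monotonicity requires.
        Comparison with \<open>?B\<close> then yields \<open>?J \<le> a + \<epsilon> * v\<close>,
        against the choice of \<epsilon>.\<close>
      have "?J + (\<integral>x. ?e \<epsilon> x \<partial>lebesgue) = (\<integral>x. ?\<phi> (f x) + ?e \<epsilon> x \<partial>lebesgue)"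
        using \<epsilon> by simp
      also have "\<dots> \<le> (\<integral>x. ?F x (f x) \<partial>lebesgue)"
        using F \<epsilon> by (intro integral_mono) auto
      finally show False
        using F \<epsilon> by simp
    qed
  qed
  then show ?thesis
    by (auto simp: finite_entropy_def diff_entropy_def intro: tendsto_minus)
qed

end
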